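(* Let $E:\mathbb{R}^n\to\mathbb{R}^n$ be monotone and Lipschitz continuous with constant $L>0$, and assume that $X^*=\{x\in\mathbb{R}^n: E(x)=0\}$ is nonempty. Let $\{x_\ell\}_{\ell\ge 0}$ be an infinite sequence generated by the projection-based subspace algorithm described in the context (in either its line-search version or its fixed-step version). Then $$\liminf_{\ell\to\infty}\|E(x_\ell)\|=0.$$ Moreover, the sequence $\{x_\ell\}_{\ell\ge 0}$ converges to some $x^*\in X^*$.
   Context: Setting. $\|\cdot\|$ is the Euclidean norm on $\mathbb{R}^n$. $E:\mathbb{R}^n\to\mathbb{R}^n$ is continuous and monotone, i.e. $(E(x_1)-E(x_2))^T(x_1-x_2)\ge 0$ for all $x_1,x_2\in\mathbb{R}^n$. $P_C$ denotes the Euclidean projection onto a nonempty closed convex set $C$. Parameters: $\Delta_a\in(0,1)$, $\rho\in(0,1)$, $\gamma>1$, $\mu_{\rm init}\in(0,1]$, $\zeta\in(0,1)$, $-\infty<\beta_{\min}\le\beta_{\max}<\infty$; $L$ is the Lipschitz constant of $E$. Algorithm (exact projection rule). Given $x_0\in\mathbb{R}^n$, set $p_0=p_0^{\rm sc}=-E(x_0)$. For $\ell=0,1,2,\dots$, as long as $E(x_\ell)\ne 0$ (the algorithm stops when $E(x_\ell)=0$): (1) Step size. One of two versions is used throughout. Line-search version: $\mu_\ell$ is the first trial value $\mu$, starting from $\mu=\mu_{\rm init}$ and updated after each rejection by $\mu\leftarrow\max\{\mu/\gamma,\mu_{\min}\}$, such that $(p_\ell^{\rm sc})^TE(x_\ell+\mu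 p_\ell^{\rm sc})\le-\rho\,\mu\|p_\ell^{\rm sc}\|^2$; here $0<\mu_{\min}\le\min\{\mu_{\rm init},\Delta_a/(L+\rho)\}$. Fixed-step version: $\mu_\ell=\alpha$ for all $\ell$, where $0<\alpha\le\min\{1,\Delta_a/(L+\rho)\}$. In both versions set $\bar x_\ell=x_\ell+\mu_\ell p_\ell^{\rm sc}$. (2) Projection. Set $x_{\ell+1}=P_{\overline H_\ell}(x_\ell)$ with $\overline H_\ell=\{x:(x-\bar x_\ell)^TE(\bar x_\ell)\le 0\}$; equivalently $x_{\ell+1}=x_\ell-\lambda_\ell E(\bar x_\ell)$ with $\lambda_\ell=(x_\ell-\bar x_\ell)^TE(\bar x_\ell)/\|E(\bar x_\ell)\|^2$. (3) Direction. If $E(x_{\ell+1})\neq 0$, compute $p_{\ell+1}$ and $p_{\ell+1}^{\rm sc}$ by the direction rule below. Direction rule at index $\ell\ge1$. Write $E_\ell=E(x_\ell)$, $p=p_{\ell-1}$ (the unscaled, angle-safeguarded previous direction), $s=\bar x_{\ell-1}-x_{\ell-1}$, $y=E(\bar x_{\ell-1})-E(x_{\ell-1})$. First $y$ is safeguarded: if $s^Ty=0$, replace $y$ by $y+\varphi s$ with some $0<\varphi\le\overline\varphi$; if then $y^Tp=0$, put $u=p-\frac{s^Tp}{\|s\|^2}s$ and replace $y$ by $y+\psi\|s\|u/\|u\|$ with some $0<\psi\le\overline\psi$ ($\overline\varphi,\overline\psi>0$ constants). One of the following families, with one coefficient formula, is fixed for the whole run; every coefficient is truncated to $[\beta_{\min},\beta_{\max}]$: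 (a) $p_\ell=-E_\ell+\beta_\ell p$, with $\beta_\ell$ one of $\frac{\|E_\ell\|^2}{\|E_{\ell-1}\|^2}$, $\frac{y^TE_\ell}{\|E_{\ell-1}\|^2}$, $\frac{y^TE_\ell}{y^Tp}$, $\frac{\|E_\ell\|^2}{y^Tp}$, $-\frac{E_\ell^Ty}{E_{\ell-1}^Tp}$, $\frac{E_\ell^T(y-2\frac{\|y\|^2}{y^Tp}p)}{y^Tp}$, $\frac{E_\ell^T(y-0.1\,p)}{y^Tp}$; (b) $p_\ell=-E_\ell+\beta^1_\ell p+\beta^2_\ell y$, with $(\beta^1_\ell,\beta^2_\ell)$ equal to $\left(\frac{y^TE_\ell}{\|E_{\ell-1}\|^2},-\frac{p^TE_\ell}{\|E_{\ell-1}\|^2}\right)$ or $\left(\frac{y^TE_\ell}{y^Tp},-\frac{p^TE_\ell}{y^Tp}\right)$; (c) $p_\ell=-E_\ell+\beta^3_\ell y+\beta^4_\ell s$, with $\beta^3_\ell=-\frac{s^TE_\ell}{y^Ts}$, $\beta^4_\ell=c_\ell\beta^3_\ell+\frac{y^TE_\ell}{y^Ts}$, where, for $\phi=\|y\|^2/(y^Ts)$, $c_\ell$ is one of $1+\phi$, $1+2\phi$, $1-\min\{1,\phi\}$; (d) $p_\ell=-E_\ell+\beta_\ell p+\beta^5_\ell h_\ell$, with $\beta_\ell$ one of the coefficients in (a), $h_\ell$ an auxiliary vector with $E_\ell^Th_\ell\ne0$, $\beta^5_\ell=-\frac{(\gamma_\ell-1)\|E_\ell\|^2+\beta_\ell E_\ell^Tp}{E_\ell^Th_\ell}$,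 $\gamma_\ell=\max\{\varsigma_1,\min\{\varsigma_2,\bar\gamma_\ell\}\}$, $0<\varsigma_1\le1<\varsigma_2$, and, for a constant $\overline\gamma>0$ and $R=\frac{E_\ell^Tp}{\|E_{\ell-1}\|\,\|p\|}$, $\bar\gamma_\ell$ one of $1\pm\overline\gamma|\beta_\ell R|$, $1\pm\overline\gamma\beta_\ell R$, $1\pm\overline\gamma|R|$, $1\pm\overline\gamma R$. If $p_\ell=0$, set $p_\ell=-E_\ell$. Angle safeguard: if the angle condition $\frac{p_\ell^TE_\ell}{\|p_\ell\|\|E_\ell\|}\le-\Delta_a$ fails, let $\sigma_1=\|E_\ell\|^2$, $\sigma_2=\|p_\ell\|^2$, $\sigma=E_\ell^Tp_\ell$, $w=\frac{\sigma_1\sigma_2-\sigma^2}{1-\Delta_a^2}$; replace $p_\ell$ by $p_\ell-\frac{\sigma+\Delta_a\sqrt w}{\sigma_1}E_\ell$ if $w>0$ and by $-E_\ell$ if $w=0$. (The resulting $p_\ell$ satisfies the angle condition.) Scaling: $p_\ell^{\rm sc}=\frac{\operatorname{mid}\{\zeta\|E_\ell\|,\|p_\ell\|,\|E_\ell\|\}}{\|p_\ell\|}p_\ell$, where $\operatorname{mid}$ is the median of three numbers; hence $\zeta\|E_\ell\|\le\|p_\ell^{\rm sc}\|\le\|E_\ell\|$. *)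

theory Defs
  imports "HOL-Analysis.Analysis"
begin

definition monotone_operator :: "('a::real_inner \<Rightarrow> 'a) \<Rightarrow> bool" where
  "monotone_operator E \<longleftrightarrow> (\<forall>x1 x2. (E x1 - E x2) \<bullet> (x1 - x2) \<ge> 0)"

record psa_params =
  angle_tol :: real    (* Delta_a *)
  descent_tol :: real  (* rho *)
  scale_low :: real    (* zeta *)
  beta_min :: real
  beta_max :: real
  phi_max :: real      (* upper bound for the safeguarding constants phi *)
  psi_max :: real      (* upper bound for the safeguarding constants psi *)

definition valid_params :: "psa_params \<Rightarrow> bool" where
  "valid_params P \<longleftrightarrow>
     0 < angle_tol P \<and> angle_tol P < 1 \<and>
     0 < descent_tol P \<and> descent_tol P < 1 \<and>
     0 < scale_low P \<and> scale_low P < 1 \<and>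
     beta_min P \<le> beta_max P \<and>
     0 < phi_max P \<and> 0 < psi_max P"

datatype step_rule =
    Line_Search (mu_init: real) (mu_factor: real) (mu_min: real)
  | Fixed_Step (step_alpha: real)

text \<open>\<open>L\<close> is a Lipschitz constant of the operator; \<open>\<gamma>\<close> is the reduction factor of the line search.\<close>

fun valid_step_rule :: "psa_params \<Rightarrow> real \<Rightarrow> step_rule \<Rightarrow> bool" where
  "valid_step_rule P L (Line_Search \<mu>0 \<gamma> \<mu>1) \<longleftrightarrow>
     0 < \<mu>0 \<and> \<mu>0 \<le> 1 \<and> 1 < \<gamma> \<and>
     0 < \<mu>1 \<and> \<mu>1 \<le> min \<mu>0 (angle_tol P / (L + descent_tol P))"
| "valid_step_rule P L (Fixed_Step \<alpha>) \<longleftrightarrow>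
     0 < \<alpha> \<and> \<alpha> \<le> min 1 (angle_tol P / (L + descent_tol P))"

fun trial_step :: "real \<Rightarrow> real \<Rightarrow> real \<Rightarrow> nat \<Rightarrow> real" where
  "trial_step \<mu>0 \<gamma> \<mu>1 0 = \<mu>0"
| "trial_step \<mu>0 \<gamma> \<mu>1 (Suc k) = max (trial_step \<mu>0 \<gamma> \<mu>1 k / \<gamma>) \<mu>1"

definition accepted ::
  "psa_params \<Rightarrow> ('a::real_inner \<Rightarrow> 'a) \<Rightarrow> 'a \<Rightarrow> 'a \<Rightarrow> real \<Rightarrow> bool" where
  "accepted P E x d \<mu> \<longleftrightarrow> d \<bullet> E (x + \<mu> *\<^sub>R d) \<le> - descent_tol P * \<mu> * (norm d)\<^sup>2"

fun is_step_size ::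
  "psa_params \<Rightarrow> step_rule \<Rightarrow> ('a::real_inner \<Rightarrow> 'a) \<Rightarrow> 'a \<Rightarrow> 'a \<Rightarrow> real \<Rightarrow> bool" where
  "is_step_size P (Line_Search \<mu>0 \<gamma> \<mu>1) E x d \<mu> \<longleftrightarrow>
     (\<exists>k. \<mu> = trial_step \<mu>0 \<gamma> \<mu>1 k \<and> accepted P E x d \<mu> \<and>
          (\<forall>j<k. \<not> accepted P E x d (trial_step \<mu>0 \<gamma> \<mu>1 j)))"
| "is_step_size P (Fixed_Step \<alpha>) E x d \<mu> \<longleftrightarrow> \<mu> = \<alpha>"

text \<open>
  In the direction rule, \<open>g\<close> and \<open>g'\<close> are the operator values at the current and the
  previous iterate, \<open>p\<close> is the previous unscaled direction, and \<open>s\<close>, \<open>y\<close> are the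
  differences of points and of operator values along the previous step.

  The vector \<open>u\<close> below is orthogonal to \<open>s\<close>. In a run of the algorithm \<open>s\<close> is a positive
  multiple of \<open>p\<close>, so \<open>y1 \<bullet> p\<close> is already nonzero and the case \<open>u = 0\<close> is immaterial.
\<close>

definition safeguarded_y ::
  "psa_params \<Rightarrow> 'a::real_inner \<Rightarrow> 'a \<Rightarrow> 'a \<Rightarrow> 'a \<Rightarrow> bool" where
  "safeguarded_y P p s y0 y \<longleftrightarrow>
     (\<exists>\<phi> \<psi>. 0 < \<phi> \<and> \<phi> \<le> phi_max P \<and> 0 < \<psi> \<and> \<psi> \<le> psi_max P \<and>
       (let y1 = (if s \<bullet> y0 = 0 then y0 + \<phi> *\<^sub>R s else y0);
            u = p - (s \<bullet> p / (norm s)\<^sup>2) *\<^sub>R s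
        in y = (if y1 \<bullet> p = 0 then y1 + (\<psi> * norm s / norm u) *\<^sub>R u else y1)))"

definition truncate_coeff :: "psa_params \<Rightarrow> real \<Rightarrow> real" where
  "truncate_coeff P t = max (beta_min P) (min (beta_max P) t)"

datatype cg_rule =
  Fletcher_Reeves | Polak_Ribiere | Hestenes_Stiefel | Dai_Yuan | Liu_Storey | Hager_Zhang | Dai_Liao

fun cg_coeff :: "cg_rule \<Rightarrow> 'a::real_inner \<Rightarrow> 'a \<Rightarrow> 'a \<Rightarrow> 'a \<Rightarrow> real" where
  "cg_coeff Fletcher_Reeves g g' p y = (norm g)\<^sup>2 / (norm g')\<^sup>2"
| "cg_coeff Polak_Ribiere g g' p y = (y \<bullet> g) / (norm g')\<^sup>2"
| "cg_coeff Hestenes_Stiefel g g' p y = (y \<bullet> g) / (y \<bullet> p)"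
| "cg_coeff Dai_Yuan g g' p y = (norm g)\<^sup>2 / (y \<bullet> p)"
| "cg_coeff Liu_Storey g g' p y = - ((g \<bullet> y) / (g' \<bullet> p))"
| "cg_coeff Hager_Zhang g g' p y =
     (g \<bullet> (y - (2 * ((norm y)\<^sup>2 / (y \<bullet> p))) *\<^sub>R p)) / (y \<bullet> p)"
| "cg_coeff Dai_Liao g g' p y = (g \<bullet> (y - (1 / 10) *\<^sub>R p)) / (y \<bullet> p)"

datatype three_term_rule = Three_Term_PR | Three_Term_HS

fun three_term_denom :: "three_term_rule \<Rightarrow> 'a::real_inner \<Rightarrow> 'a \<Rightarrow> 'a \<Rightarrow> real" where
  "three_term_denom Three_Term_PR g' p y = (norm g')\<^sup>2"
| "three_term_denom Three_Term_HS g' p y = y \<bullet> p"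

datatype quasi_newton_rule = One_Plus_Phi | One_Plus_Two_Phi | One_Minus_Min_Phi

fun quasi_newton_c :: "quasi_newton_rule \<Rightarrow> real \<Rightarrow> real" where
  "quasi_newton_c One_Plus_Phi \<phi> = 1 + \<phi>"
| "quasi_newton_c One_Plus_Two_Phi \<phi> = 1 + 2 * \<phi>"
| "quasi_newton_c One_Minus_Min_Phi \<phi> = 1 - min 1 \<phi>"

datatype gamma_rule = Abs_Beta_R | Beta_R | Abs_R | Plain_R

datatype pm_sign = Plus | Minus

fun gamma_term :: "gamma_rule \<Rightarrow> real \<Rightarrow> real \<Rightarrow> real" where
  "gamma_term Abs_Beta_R \<beta> R = \<bar>\<beta> * R\<bar>"
| "gamma_term Beta_R \<beta> R = \<beta> * R"
| "gamma_term Abs_R \<beta> R = \<bar>R\<bar>"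
| "gamma_term Plain_R \<beta> R = R"

fun gamma_bar :: "pm_sign \<Rightarrow> gamma_rule \<Rightarrow> real \<Rightarrow> real \<Rightarrow> real \<Rightarrow> real" where
  "gamma_bar Plus r c \<beta> R = 1 + c * gamma_term r \<beta> R"
| "gamma_bar Minus r c \<beta> R = 1 - c * gamma_term r \<beta> R"

text \<open>
  The four families of subspace directions. The real arguments of \<open>Family_D\<close> are the bounds
  \<open>\<tau>1\<close>, \<open>\<tau>2\<close> and the constant multiplying the correction term in \<^const>\<open>gamma_bar\<close>.
\<close>

datatype direction_rule =
    Family_A cg_rule
  | Family_B three_term_rule
  | Family_C quasi_newton_rule
  | Family_D cg_rule pm_sign gamma_rule real real real

fun valid_direction_rule :: "direction_rule \<Rightarrow> bool" where
  "valid_direction_rule (Family_D r sg gr \<tau>1 \<tau>2 c) \<longleftrightarrow> 0 < \<tau>1 \<and> \<tau>1 \<le> 1 \<and> 1 < \<tau>2 \<and> 0 < c"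
| "valid_direction_rule _ \<longleftrightarrow> True"

text \<open>
  A coefficient occurring inside the formula of another coefficient (\<open>\<beta>3\<close> in \<open>\<beta>4\<close>, and \<open>\<beta>\<close> in
  \<open>\<beta>5\<close> and in \<open>\<gamma>\<close>) is the truncated one. The auxiliary vector \<open>h\<close> may change from one
  iteration to the next.
\<close>

fun is_subspace_direction ::
  "psa_params \<Rightarrow> direction_rule \<Rightarrow> 'a::real_inner \<Rightarrow> 'a \<Rightarrow> 'a \<Rightarrow> 'a \<Rightarrow> 'a \<Rightarrow> 'a \<Rightarrow> bool" where
  "is_subspace_direction P (Family_A r) g g' p s y d \<longleftrightarrow>
     d = - g + truncate_coeff P (cg_coeff r g g' p y) *\<^sub>R p"
| "is_subspace_direction P (Family_B r) g g' p s y d \<longleftrightarrow>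
     (let \<beta>1 = truncate_coeff P ((y \<bullet> g) / three_term_denom r g' p y);
          \<beta>2 = truncate_coeff P (- ((p \<bullet> g) / three_term_denom r g' p y))
      in d = - g + \<beta>1 *\<^sub>R p + \<beta>2 *\<^sub>R y)"
| "is_subspace_direction P (Family_C r) g g' p s y d \<longleftrightarrow>
     (let c = quasi_newton_c r ((norm y)\<^sup>2 / (y \<bullet> s));
          \<beta>3 = truncate_coeff P (- ((s \<bullet> g) / (y \<bullet> s)));
          \<beta>4 = truncate_coeff P (c * \<beta>3 + (y \<bullet> g) / (y \<bullet> s))
      in d = - g + \<beta>3 *\<^sub>R y + \<beta>4 *\<^sub>R s)"
| "is_subspace_direction P (Family_D r sg gr \<tau>1 \<tau>2 c) g g' p s y d \<longleftrightarrow>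
     (\<exists>h. g \<bullet> h \<noteq> 0 \<and>
       (let \<beta> = truncate_coeff P (cg_coeff r g g' p y);
            R = (g \<bullet> p) / (norm g' * norm p);
            \<gamma> = max \<tau>1 (min \<tau>2 (gamma_bar sg gr c \<beta> R));
            \<beta>5 = truncate_coeff P (- (((\<gamma> - 1) * (norm g)\<^sup>2 + \<beta> * (g \<bullet> p)) / (g \<bullet> h)))
        in d = - g + \<beta> *\<^sub>R p + \<beta>5 *\<^sub>R h))"

text \<open>By the Cauchy--Schwarz inequality, \<open>w\<close> is never negative.\<close>

definition angle_safeguard :: "psa_params \<Rightarrow> 'a::real_inner \<Rightarrow> 'a \<Rightarrow> 'a" where
  "angle_safeguard P g p =
     (let \<Delta> = angle_tol P; \<sigma>1 = (norm g)\<^sup>2; \<sigma>2 = (norm p)\<^sup>2; \<sigma> = g \<bullet> p;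
          w = (\<sigma>1 * \<sigma>2 - \<sigma>\<^sup>2) / (1 - \<Delta>\<^sup>2)
      in if (p \<bullet> g) / (norm p * norm g) \<le> - \<Delta> then p
         else if w > 0 then p - ((\<sigma> + \<Delta> * sqrt w) / \<sigma>1) *\<^sub>R g
         else - g)"

definition is_next_direction ::
  "psa_params \<Rightarrow> direction_rule \<Rightarrow> 'a::real_inner \<Rightarrow> 'a \<Rightarrow> 'a \<Rightarrow> 'a \<Rightarrow> 'a \<Rightarrow> 'a \<Rightarrow> bool" where
  "is_next_direction P D g g' p s y0 q \<longleftrightarrow>
     (\<exists>y d. safeguarded_y P p s y0 y \<and> is_subspace_direction P D g g' p s y d \<and>
            q = angle_safeguard P g (if d = 0 then - g else d))"

definition median3 :: "real \<Rightarrow> real \<Rightarrow> real \<Rightarrow> real" where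
  "median3 a b c = max (min a b) (min (max a b) c)"

definition scaled_direction :: "psa_params \<Rightarrow> 'a::real_inner \<Rightarrow> 'a \<Rightarrow> 'a" where
  "scaled_direction P g p =
     (median3 (scale_low P * norm g) (norm p) (norm g) / norm p) *\<^sub>R p"

text \<open>
  An infinite run: \<open>x\<close> iterates, \<open>xb\<close> intermediate points, \<open>\<mu>\<close> step sizes, \<open>p\<close> and \<open>ps\<close>
  unscaled and scaled directions. Since the algorithm stops at a zero of \<open>E\<close>, an infinite run
  never visits one.
\<close>

definition psa_run ::
  "psa_params \<Rightarrow> step_rule \<Rightarrow> direction_rule \<Rightarrow> ('a::euclidean_space \<Rightarrow> 'a) \<Rightarrow>
   (nat \<Rightarrow> 'a) \<Rightarrow> (nat \<Rightarrow> 'a) \<Rightarrow> (nat \<Rightarrow> real) \<Rightarrow> (nat \<Rightarrow> 'a) \<Rightarrow> (nat \<Rightarrow> 'a) \<Rightarrow> bool" where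
  "psa_run P S D E x xb \<mu> p ps \<longleftrightarrow>
     (\<forall>l. E (x l) \<noteq> 0) \<and>
     p 0 = - E (x 0) \<and> ps 0 = p 0 \<and>
     (\<forall>l. is_step_size P S E (x l) (ps l) (\<mu> l)) \<and>
     (\<forall>l. xb l = x l + \<mu> l *\<^sub>R ps l) \<and>
     (\<forall>l. x (Suc l) = closest_point {z. (z - xb l) \<bullet> E (xb l) \<le> 0} (x l)) \<and>
     (\<forall>l. is_next_direction P D (E (x (Suc l))) (E (x l)) (p l)
            (xb l - x l) (E (xb l) - E (x l)) (p (Suc l))) \<and>
     (\<forall>l. ps (Suc l) = scaled_direction P (E (x (Suc l))) (p (Suc l)))"

definition psa_generates ::
  "psa_params \<Rightarrow> step_rule \<Rightarrow> direction_rule \<Rightarrow> ('a::euclidean_space \<Rightarrow> 'a) \<Rightarrow> (nat \<Rightarrow> 'a) \<Rightarrow> bool" where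
  "psa_generates P S D E x \<longleftrightarrow> (\<exists>xb \<mu> p ps. psa_run P S D E x xb \<mu> p ps)"

end

theory Submission
  imports Defs
begin

text \<open>
  Whatever direction a subspace family produces, the angle safeguard and the scaling turn it into
  a vector \<open>d\<close> whose angle with \<open>- E (x l)\<close> is bounded away from \<open>\<pi> / 2\<close> and whose length is
  comparable to \<open>\<parallel>E (x l)\<parallel>\<close> (\<open>angle_safeguard_angle\<close>, \<open>norm_scaled_direction\<close>). The step size
  \<open>\<mu>\<close> lies between a positive constant and \<open>1\<close> and satisfies \<open>d \<bullet> E (xb l) \<le> - \<rho> \<mu> \<parallel>d\<parallel>\<^sup>2\<close>:
  a line search accepts only such steps, and for a fixed step the inequality follows from the
  angle condition, Lipschitz continuity and the bound on \<open>\<alpha>\<close> (\<open>accepted_of_small_step\<close>).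

  Geometrically, the hyperplane through \<open>xb l\<close> with normal \<open>E (xb l)\<close> separates \<open>x l\<close> from all
  zeros of \<open>E\<close>. That the zeros lie on the far side is monotonicity, so projecting onto the far
  half-space is Fejer monotone: the squared distance to every zero drops by at least
  \<open>\<parallel>x (l + 1) - x l\<parallel>\<^sup>2\<close>, and hence \<open>x (l + 1) - x l \<longlongrightarrow> 0\<close>. The descent inequality says
  that \<open>x l\<close> is far from the hyperplane, namely \<open>\<parallel>x (l + 1) - x l\<parallel> \<ge> c \<parallel>E (x l)\<parallel>\<close> with a
  constant \<open>c > 0\<close> (\<open>halfspace_projection_step_length\<close>). So the whole sequence \<open>E (x l)\<close> tends
  to \<open>0\<close>. Being bounded, the iterates have a cluster point, which is a zero of \<open>E\<close> by continuity,
  and a Fejer monotone sequence converges to any cluster point that lies in its target set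
  (\<open>fejer_monotone_convergence\<close>).
\<close>

section \<open>Fejer monotone sequences\<close>

text \<open>
  The distance to the cluster point decreases along the whole sequence and vanishes in the limit
  along a subsequence.
\<close>

lemma fejer_monotone_convergence:
  fixes x :: "nat \<Rightarrow> 'a::heine_borel"
  assumes fejer: "\<And>z n. z \<in> Z \<Longrightarrow> dist (x (Suc n)) z \<le> dist (x n) z"
    and "Z \<noteq> {}"
    and cluster: "\<And>r z. strict_mono r \<Longrightarrow> (x \<circ> r) \<longlonglongrightarrow> z \<Longrightarrow> z \<in> Z"
  shows "\<exists>z\<in>Z. x \<longlonglongrightarrow> z"
proof -
  have anti: "dist (x n) z \<le> dist (x m) z" if "z \<in> Z" "m \<le> n" for z m n
    using lift_Suc_antimono_le[of "\<lambda>n. dist (x n) z"] fejer that by blast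
  obtain z0 where "z0 \<in> Z" using \<open>Z \<noteq> {}\<close> by blast
  then have "range x \<subseteq> cball z0 (dist (x 0) z0)"
    using anti[of z0 0] by (auto simp: dist_commute)
  then have "bounded (range x)" by (rule bounded_subset[OF bounded_cball])
  then obtain z r where r: "strict_mono (r :: nat \<Rightarrow> nat)" "(x \<circ> r) \<longlonglongrightarrow> z"
    using bounded_imp_convergent_subsequence by blast
  then have z: "z \<in> Z" by (rule cluster)
  have "x \<longlonglongrightarrow> z"
  proof (rule metric_LIMSEQ_I)
    fix e :: real assume "0 < e"
    then obtain k where "dist ((x \<circ> r) k) z < e"
      using metric_LIMSEQ_D[OF r(2)] by blast
    then have "dist (x n) z < e" if "r k \<le> n" for n
      using anti[OF z that] by simp
    then show "\<exists>N. \<forall>n\<ge>N. dist (x n) z < e" by blast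
  qed
  with z show ?thesis by blast
qed

text \<open>
  The squared distances to \<open>z\<close> converge as a decreasing sequence of nonnegative reals, and their
  consecutive differences dominate the squared steps.
\<close>

lemma steps_tendsto_zero_of_square_decrease:
  fixes x :: "nat \<Rightarrow> 'a::real_normed_vector"
  assumes "\<And>n. (norm (x (Suc n) - z))\<^sup>2 \<le> (norm (x n - z))\<^sup>2 - (norm (x n - x (Suc n)))\<^sup>2"
  shows "(\<lambda>n. norm (x n - x (Suc n))) \<longlonglongrightarrow> 0"
proof -
  define a where "a n = (norm (x n - z))\<^sup>2" for n
  have step: "(norm (x n - x (Suc n)))\<^sup>2 \<le> a n - a (Suc n)" for n
    using assms[of n] unfolding a_def by linarith
  have "decseq a"
    by (rule decseq_SucI) (smt (verit) step zero_le_power2)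
  moreover have "a n \<ge> 0" for n by (simp add: a_def)
  ultimately obtain c where c: "a \<longlonglongrightarrow> c" using decseq_convergent by metis
  have "(\<lambda>n. a n - a (Suc n)) \<longlonglongrightarrow> c - c"
    by (intro tendsto_diff c LIMSEQ_Suc)
  then have "(\<lambda>n. a n - a (Suc n)) \<longlonglongrightarrow> 0" by simp
  then have "(\<lambda>n. (norm (x n - x (Suc n)))\<^sup>2) \<longlonglongrightarrow> 0"
    by (rule Lim_null_comparison[rotated]) (use step in auto)
  then have "(\<lambda>n. sqrt ((norm (x n - x (Suc n)))\<^sup>2)) \<longlonglongrightarrow> sqrt 0"
    by (rule tendsto_real_sqrt)
  then show ?thesis by simp
qed

section \<open>Projection onto the separating half-space\<close>

text \<open>
  The angle at the projection between \<open>a\<close> and any other point of \<open>C\<close> is not acute, so the cosine theorem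
  gives an inequality of Pythagorean type.
\<close>

lemma closest_point_square_decrease:
  fixes a z :: "'a::euclidean_space"
  assumes "convex C" "closed C" "z \<in> C"
  shows "(norm (closest_point C a - z))\<^sup>2 \<le> (norm (a - z))\<^sup>2 - (norm (a - closest_point C a))\<^sup>2"
proof -
  have "(a - closest_point C a) \<bullet> (z - closest_point C a) \<le> 0"
    using assms by (rule closest_point_dot)
  then show ?thesis
    unfolding power2_norm_eq_inner by (simp add: inner_diff inner_commute)
qed

lemma halfspace_through_convex_closed:
  fixes b v :: "'a::euclidean_space"
  shows "convex {z. (z - b) \<bullet> v \<le> 0}" "closed {z. (z - b) \<bullet> v \<le> 0}"
proof -
  have eq: "{z. (z - b) \<bullet> v \<le> 0} = {z. v \<bullet> z \<le> v \<bullet> b}"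
    by (auto simp: inner_diff inner_commute)
  show "convex {z. (z - b) \<bullet> v \<le> 0}" "closed {z. (z - b) \<bullet> v \<le> 0}"
    unfolding eq by (rule convex_halfspace_le closed_halfspace_le)+
qed

lemma zero_in_separating_halfspace:
  assumes "monotone_operator E" "E z = 0"
  shows "(z - b) \<bullet> E b \<le> 0"
proof -
  have "0 \<le> (E b - E z) \<bullet> (b - z)" using assms(1) by (auto simp: monotone_operator_def)
  then show ?thesis using assms(2) by (simp add: inner_diff inner_commute)
qed

text \<open>
  The projection leaves \<open>a\<close> behind by at least its distance \<open>(a - b) \<bullet> E b / \<parallel>E b\<parallel>\<close> to the
  hyperplane. Here the numerator is of order \<open>\<parallel>E a\<parallel>\<^sup>2\<close> by the descent inequality, and the
  denominator is at most of order \<open>\<parallel>E a\<parallel>\<close> because \<open>b\<close> is within \<open>\<parallel>E a\<parallel>\<close> of \<open>a\<close>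
  and \<open>E\<close> is Lipschitz continuous.
\<close>

lemma halfspace_projection_step_length:
  fixes E :: "'a::euclidean_space \<Rightarrow> 'a"
  assumes lip: "L-lipschitz_on UNIV E"
    and b: "b = a + \<mu> *\<^sub>R d"
    and descent: "d \<bullet> E b \<le> - \<rho> * \<mu> * (norm d)\<^sup>2"
    and \<mu>: "0 < m" "m \<le> \<mu>" "\<mu> \<le> 1" and "0 < \<rho>"
    and d: "0 \<le> \<zeta>" "\<zeta> * norm (E a) \<le> norm d" "norm d \<le> norm (E a)"
  shows "\<rho> * m\<^sup>2 * \<zeta>\<^sup>2 * norm (E a)
         \<le> (1 + L) * norm (a - closest_point {z. (z - b) \<bullet> E b \<le> 0} a)"
proof (cases "E a = 0")
  case True
  then show ?thesis using lipschitz_on_nonneg[OF lip] by simp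
next
  case False
  define c where "c = closest_point {z. (z - b) \<bullet> E b \<le> 0} a"
  have L: "0 \<le> L" by (rule lipschitz_on_nonneg[OF lip])
  have "b \<in> {z. (z - b) \<bullet> E b \<le> 0}" by simp
  then have "c \<in> {z. (z - b) \<bullet> E b \<le> 0}"
    unfolding c_def using closest_point_in_set[OF halfspace_through_convex_closed(2)] by blast
  then have "(a - b) \<bullet> E b \<le> (a - c) \<bullet> E b" by (simp add: inner_diff_left)
  also have "\<dots> \<le> norm (a - c) * norm (E b)" by (rule norm_cauchy_schwarz)
  also have "\<dots> \<le> norm (a - c) * ((1 + L) * norm (E a))"
  proof (rule mult_left_mono)
    have "norm (E b - E a) \<le> L * norm (b - a)"
      using lipschitz_onD[OF lip, of b a] by (simp add: dist_norm)
    also have "norm (b - a) = \<mu> * norm d" using b \<mu> by simp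
    also have "\<mu> * norm d \<le> 1 * norm (E a)" using \<mu> d by (intro mult_mono) auto
    finally have "norm (E b - E a) \<le> L * norm (E a)" using L by (simp add: mult_left_mono)
    then show "norm (E b) \<le> (1 + L) * norm (E a)"
      using norm_triangle_ineq[of "E b - E a" "E a"] by (simp add: algebra_simps)
  qed simp
  finally have upper: "(a - b) \<bullet> E b \<le> (1 + L) * norm (a - c) * norm (E a)"
    by (simp add: ac_simps)
  have "m\<^sup>2 * (\<zeta> * norm (E a))\<^sup>2 \<le> \<mu>\<^sup>2 * (norm d)\<^sup>2"
    using \<mu> d by (intro mult_mono power_mono) auto
  then have "\<rho> * (m\<^sup>2 * (\<zeta> * norm (E a))\<^sup>2) \<le> \<rho> * (\<mu>\<^sup>2 * (norm d)\<^sup>2)"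
    using \<open>0 < \<rho>\<close> by (intro mult_left_mono) auto
  also have "\<dots> = \<mu> * (\<rho> * \<mu> * (norm d)\<^sup>2)" by (simp add: power2_eq_square)
  also have "\<dots> \<le> \<mu> * (- (d \<bullet> E b))" using descent \<mu> by (intro mult_left_mono) auto
  also have "\<dots> = (a - b) \<bullet> E b" using b by simp
  finally have "(\<rho> * m\<^sup>2 * \<zeta>\<^sup>2 * norm (E a)) * norm (E a) \<le> (1 + L) * norm (a - c) * norm (E a)"
    using upper by (simp add: power2_eq_square ac_simps)
  then show ?thesis using False unfolding c_def by simp
qed

section \<open>Safeguarded and scaled directions\<close>

text \<open>
  When the correction fires with \<open>w > 0\<close>, its coefficient solves the quadratic equation that says
  that the angle condition holds with equality: with \<open>q\<close> the corrected direction,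
  \<open>g \<bullet> q = - \<Delta> sqrt w\<close> and \<open>\<parallel>q\<parallel>\<^sup>2 \<parallel>g\<parallel>\<^sup>2 = w\<close>.
\<close>

lemma angle_safeguard_angle:
  fixes g p :: "'a::real_inner"
  assumes P: "0 < angle_tol P" "angle_tol P < 1" and "g \<noteq> 0" "p \<noteq> 0"
  defines "q \<equiv> angle_safeguard P g p"
  shows "q \<noteq> 0" "q \<bullet> g \<le> - angle_tol P * (norm q * norm g)"
proof -
  define \<Delta> where "\<Delta> = angle_tol P"
  define w where "w = ((norm g)\<^sup>2 * (norm p)\<^sup>2 - (g \<bullet> p)\<^sup>2) / (1 - \<Delta>\<^sup>2)"
  have \<Delta>: "0 < \<Delta>" "\<Delta> < 1" using P by (auto simp: \<Delta>_def)
  have q: "q = (if (p \<bullet> g) / (norm p * norm g) \<le> - \<Delta> then p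
                else if w > 0 then p - ((g \<bullet> p + \<Delta> * sqrt w) / (norm g)\<^sup>2) *\<^sub>R g else - g)"
    unfolding q_def angle_safeguard_def Let_def w_def \<Delta>_def by simp
  have "q \<noteq> 0 \<and> q \<bullet> g \<le> - \<Delta> * (norm q * norm g)"
  proof (cases "(p \<bullet> g) / (norm p * norm g) \<le> - \<Delta>")
    case True
    then show ?thesis using q \<open>p \<noteq> 0\<close> \<open>g \<noteq> 0\<close> by (simp add: divide_le_eq)
  next
    case angle: False
    show ?thesis
    proof (cases "w > 0")
      case True
      define t where "t = (g \<bullet> p + \<Delta> * sqrt w) / (norm g)\<^sup>2"
      have qt: "q = p - t *\<^sub>R g" using angle True by (simp add: q t_def)
      have tg: "t * (norm g)\<^sup>2 = g \<bullet> p + \<Delta> * sqrt w" using \<open>g \<noteq> 0\<close> by (simp add: t_def)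
      have qg: "q \<bullet> g = - \<Delta> * sqrt w"
        using tg by (simp add: qt inner_diff inner_commute power2_norm_eq_inner)
      have "\<Delta>\<^sup>2 < 1" using \<Delta> by (simp add: abs_square_less_1)
      then have "(norm g)\<^sup>2 * (norm p)\<^sup>2 - (g \<bullet> p)\<^sup>2 = w * (1 - \<Delta>\<^sup>2)" by (simp add: w_def)
      moreover have "(norm q)\<^sup>2 * (norm g)\<^sup>2
          = (norm g)\<^sup>2 * (norm p)\<^sup>2 - 2 * (t * (norm g)\<^sup>2) * (g \<bullet> p) + (t * (norm g)\<^sup>2)\<^sup>2"
        by (simp add: qt power2_norm_eq_inner inner_diff inner_commute)
          (simp add: algebra_simps power2_eq_square)
      moreover have "(sqrt w)\<^sup>2 = w" using True by simp
      ultimately have "(norm q * norm g)\<^sup>2 = w"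
        unfolding tg power_mult_distrib by algebra
      then have "norm q * norm g = sqrt w" by (metis norm_ge_zero mult_nonneg_nonneg real_sqrt_unique)
      then show ?thesis using qg True by auto
    next
      case False
      then have "q = - g" using angle q by simp
      moreover have "\<Delta> * (norm g)\<^sup>2 \<le> 1 * (norm g)\<^sup>2" using \<Delta> by (intro mult_right_mono) auto
      ultimately show ?thesis using \<open>g \<noteq> 0\<close> by (simp add: power2_eq_square flip: power2_norm_eq_inner)
    qed
  qed
  then show "q \<noteq> 0" "q \<bullet> g \<le> - angle_tol P * (norm q * norm g)" by (auto simp: \<Delta>_def)
qed

lemma median3_bounds:
  assumes "a \<le> c"
  shows "a \<le> median3 a b c" "median3 a b c \<le> c"
  using assms by (auto simp: median3_def)

lemma norm_scaled_direction:
  fixes g p :: "'a::real_inner"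
  assumes "scale_low P < 1" "0 < scale_low P" "p \<noteq> 0"
  shows "scale_low P * norm g \<le> norm (scaled_direction P g p)"
    and "norm (scaled_direction P g p) \<le> norm g"
proof -
  have le: "scale_low P * norm g \<le> norm g" using assms by (simp add: mult_left_le_one_le)
  have "0 \<le> scale_low P * norm g" using assms by simp
  then have "0 \<le> median3 (scale_low P * norm g) (norm p) (norm g)"
    using median3_bounds(1)[OF le] by (rule order_trans)
  then have "norm (scaled_direction P g p) = median3 (scale_low P * norm g) (norm p) (norm g)"
    using assms by (simp add: scaled_direction_def)
  then show "scale_low P * norm g \<le> norm (scaled_direction P g p)"
    and "norm (scaled_direction P g p) \<le> norm g"
    using median3_bounds[OF le] by auto
qed

lemma scaled_direction_angle:
  fixes g p :: "'a::real_inner"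
  assumes "0 < scale_low P" "scale_low P < 1" "p \<bullet> g \<le> - \<Delta> * (norm p * norm g)"
  shows "scaled_direction P g p \<bullet> g \<le> - \<Delta> * (norm (scaled_direction P g p) * norm g)"
proof -
  define k where "k = median3 (scale_low P * norm g) (norm p) (norm g) / norm p"
  have "0 \<le> scale_low P * norm g" "scale_low P * norm g \<le> norm g"
    using assms(1,2) by (simp_all add: mult_left_le_one_le)
  then have "0 \<le> k"
    unfolding k_def using median3_bounds(1) by (intro divide_nonneg_nonneg) (auto intro: order_trans)
  then have "k * (p \<bullet> g) \<le> k * (- \<Delta> * (norm p * norm g))"
    using assms(3) by (rule mult_left_mono[rotated])
  then show ?thesis
    using \<open>0 \<le> k\<close> by (simp add: scaled_direction_def ac_simps flip: k_def)
qed

section \<open>Step sizes\<close>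

lemma trial_step_bounds:
  assumes "0 < \<mu>1" "\<mu>1 \<le> \<mu>0" "1 < \<gamma>"
  shows "\<mu>1 \<le> trial_step \<mu>0 \<gamma> \<mu>1 k \<and> trial_step \<mu>0 \<gamma> \<mu>1 k \<le> \<mu>0"
proof (induction k)
  case (Suc k)
  then have "trial_step \<mu>0 \<gamma> \<mu>1 k / \<gamma> \<le> trial_step \<mu>0 \<gamma> \<mu>1 k"
    using assms by (simp add: divide_le_eq mult_le_cancel_left1)
  with Suc assms show ?case by auto
qed (use assms in auto)

text \<open>
  Over a step of length \<open>\<mu> \<parallel>d\<parallel>\<close> the inner product with \<open>d\<close> grows by at most \<open>L \<mu> \<parallel>d\<parallel>\<^sup>2\<close> from
  its initial value, which is at most \<open>- \<Delta> \<parallel>d\<parallel>\<^sup>2\<close> by the angle condition and \<open>\<parallel>d\<parallel> \<le> \<parallel>E a\<parallel>\<close>.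
\<close>

lemma accepted_of_small_step:
  fixes E :: "'a::real_inner \<Rightarrow> 'a"
  assumes lip: "L-lipschitz_on UNIV E"
    and angle: "d \<bullet> E a \<le> - angle_tol P * (norm d * norm (E a))"
    and "norm d \<le> norm (E a)" "0 \<le> angle_tol P"
    and \<mu>: "0 \<le> \<mu>" "\<mu> * (L + descent_tol P) \<le> angle_tol P"
  shows "accepted P E a d \<mu>"
proof -
  have "angle_tol P * (norm d * norm d) \<le> angle_tol P * (norm d * norm (E a))"
    using assms by (intro mult_left_mono) auto
  then have initial: "d \<bullet> E a \<le> - angle_tol P * (norm d)\<^sup>2"
    using angle by (simp add: power2_eq_square)
  have "d \<bullet> (E (a + \<mu> *\<^sub>R d) - E a) \<le> norm d * norm (E (a + \<mu> *\<^sub>R d) - E a)"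
    by (rule norm_cauchy_schwarz)
  also have "\<dots> \<le> norm d * (L * (\<mu> * norm d))"
    using lipschitz_onD[OF lip, of "a + \<mu> *\<^sub>R d" a] \<mu>
    by (intro mult_left_mono) (auto simp: dist_norm)
  finally have "d \<bullet> E (a + \<mu> *\<^sub>R d) \<le> (L * \<mu> - angle_tol P) * (norm d)\<^sup>2"
    using initial by (simp add: inner_diff_right power2_eq_square algebra_simps)
  also have "\<dots> \<le> (- descent_tol P * \<mu>) * (norm d)\<^sup>2"
    using \<mu> by (intro mult_right_mono) (auto simp: algebra_simps)
  finally show ?thesis by (simp add: accepted_def)
qed

fun step_lower_bound :: "step_rule \<Rightarrow> real" where
  "step_lower_bound (Line_Search \<mu>0 \<gamma> \<mu>1) = \<mu>1"
| "step_lower_bound (Fixed_Step \<alpha>) = \<alpha>"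

lemma step_size_properties:
  fixes E :: "'a::real_inner \<Rightarrow> 'a"
  assumes lip: "L-lipschitz_on UNIV E"
    and P: "valid_params P" and S: "valid_step_rule P L S"
    and angle: "d \<bullet> E a \<le> - angle_tol P * (norm d * norm (E a))"
    and d: "norm d \<le> norm (E a)"
    and step: "is_step_size P S E a d \<mu>"
  shows "0 < step_lower_bound S" "step_lower_bound S \<le> \<mu>" "\<mu> \<le> 1" "accepted P E a d \<mu>"
proof -
  have "0 < step_lower_bound S \<and> step_lower_bound S \<le> \<mu> \<and> \<mu> \<le> 1 \<and> accepted P E a d \<mu>"
  proof (cases S)
    case (Line_Search \<mu>0 \<gamma> \<mu>1)
    then have \<mu>: "0 < \<mu>1" "\<mu>1 \<le> \<mu>0" "1 < \<gamma>" "\<mu>0 \<le> 1"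
      and "\<exists>k. \<mu> = trial_step \<mu>0 \<gamma> \<mu>1 k" "accepted P E a d \<mu>"
      using S step by auto
    then obtain k where "\<mu> = trial_step \<mu>0 \<gamma> \<mu>1 k" by blast
    then have "\<mu>1 \<le> \<mu>" "\<mu> \<le> 1"
      using trial_step_bounds[OF \<mu>(1-3), of k] \<mu>(4) by auto
    with \<mu> \<open>accepted P E a d \<mu>\<close> show ?thesis by (simp add: Line_Search)
  next
    case (Fixed_Step \<alpha>)
    then have \<alpha>: "0 < \<alpha>" "\<alpha> \<le> 1" "\<alpha> \<le> angle_tol P / (L + descent_tol P)" "\<mu> = \<alpha>"
      using S step by auto
    have "0 < L + descent_tol P"
      using P lipschitz_on_nonneg[OF lip] by (simp add: valid_params_def)
    then have "\<alpha> * (L + descent_tol P) \<le> angle_tol P" using \<alpha> by (simp add: pos_le_divide_eq)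
    moreover have "0 \<le> angle_tol P" using P by (simp add: valid_params_def)
    ultimately have "accepted P E a d \<alpha>"
      using accepted_of_small_step[OF lip angle d] \<alpha> by simp
    then show ?thesis using Fixed_Step \<alpha> by simp
  qed
  then show "0 < step_lower_bound S" "step_lower_bound S \<le> \<mu>" "\<mu> \<le> 1" "accepted P E a d \<mu>"
    by auto
qed

section \<open>Convergence of the algorithm\<close>

text \<open>
  For \<open>l = 0\<close> the direction \<open>- E (x 0)\<close> has the three properties directly; afterwards the first
  comes from the safeguard and survives the scaling, which provides the other two. The safeguard
  can be applied because a vanishing direction is replaced by \<open>- E (x l)\<close>, which is nonzero in an
  infinite run.
\<close>

lemma psa_run_direction:
  assumes run: "psa_run P S D E x xb \<mu> p ps" and P: "valid_params P"
  shows "ps l \<bullet> E (x l) \<le> - angle_tol P * (norm (ps l) * norm (E (x l)))"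
    and "scale_low P * norm (E (x l)) \<le> norm (ps l)"
    and "norm (ps l) \<le> norm (E (x l))"
proof -
  have par: "0 < angle_tol P" "angle_tol P < 1" "0 < scale_low P" "scale_low P < 1"
    using P by (auto simp: valid_params_def)
  have E: "E (x k) \<noteq> 0" for k using run by (simp add: psa_run_def)
  have "ps l \<bullet> E (x l) \<le> - angle_tol P * (norm (ps l) * norm (E (x l)))
        \<and> scale_low P * norm (E (x l)) \<le> norm (ps l) \<and> norm (ps l) \<le> norm (E (x l))"
  proof (cases l)
    case 0
    have ps: "ps 0 = - E (x 0)" using run by (simp add: psa_run_def)
    have "angle_tol P * (norm (E (x 0)))\<^sup>2 \<le> 1 * (norm (E (x 0)))\<^sup>2"
      using par by (intro mult_right_mono) auto
    moreover have "scale_low P * norm (E (x 0)) \<le> 1 * norm (E (x 0))"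
      using par by (intro mult_right_mono) auto
    ultimately show ?thesis
      by (simp add: 0 ps power2_eq_square flip: power2_norm_eq_inner)
  next
    case (Suc k)
    have "is_next_direction P D (E (x (Suc k))) (E (x k)) (p k)
            (xb k - x k) (E (xb k) - E (x k)) (p (Suc k))"
      and ps: "ps (Suc k) = scaled_direction P (E (x (Suc k))) (p (Suc k))"
      using run by (auto simp: psa_run_def)
    then obtain d where
      d: "p (Suc k) = angle_safeguard P (E (x (Suc k))) (if d = 0 then - E (x (Suc k)) else d)"
      by (auto simp: is_next_direction_def)
    have "(if d = 0 then - E (x (Suc k)) else d) \<noteq> 0" using E by simp
    note safe = angle_safeguard_angle[OF par(1,2) E[of "Suc k"] this, folded d]
    show ?thesis
      unfolding Suc ps
      using norm_scaled_direction[OF par(4,3) safe(1)] scaled_direction_angle[OF par(3,4) safe(2)]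
      by blast
  qed
  then show "ps l \<bullet> E (x l) \<le> - angle_tol P * (norm (ps l) * norm (E (x l)))"
    and "scale_low P * norm (E (x l)) \<le> norm (ps l)"
    and "norm (ps l) \<le> norm (E (x l))" by auto
qed

lemma psa_run_square_decrease:
  assumes run: "psa_run P S D E x xb \<mu> p ps" and "monotone_operator E" "E z = 0"
  shows "(norm (x (Suc l) - z))\<^sup>2 \<le> (norm (x l - z))\<^sup>2 - (norm (x l - x (Suc l)))\<^sup>2"
proof -
  have "x (Suc l) = closest_point {z. (z - xb l) \<bullet> E (xb l) \<le> 0} (x l)"
    using run by (simp add: psa_run_def)
  moreover have "z \<in> {z. (z - xb l) \<bullet> E (xb l) \<le> 0}"
    using zero_in_separating_halfspace assms(2,3) by blast
  ultimately show ?thesis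
    using closest_point_square_decrease[OF halfspace_through_convex_closed] by metis
qed

lemma psa_run_step_length:
  assumes run: "psa_run P S D E x xb \<mu> p ps"
    and lip: "L-lipschitz_on UNIV E"
    and P: "valid_params P" and S: "valid_step_rule P L S"
  obtains c where "0 < c" "\<And>l. norm (E (x l)) \<le> c * norm (x l - x (Suc l))"
proof -
  define k where "k = descent_tol P * (step_lower_bound S)\<^sup>2 * (scale_low P)\<^sup>2"
  have par: "0 < descent_tol P" "0 < scale_low P" using P by (auto simp: valid_params_def)
  have "is_step_size P S E (x l) (ps l) (\<mu> l)" for l using run by (simp add: psa_run_def)
  note step = step_size_properties[OF lip P S psa_run_direction(1,3)[OF run P] this]
  have "0 < k" using par step(1) by (simp add: k_def)
  have bound: "k * norm (E (x l)) \<le> (1 + L) * norm (x l - x (Suc l))" for l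
  proof -
    have xb: "xb l = x l + \<mu> l *\<^sub>R ps l"
      and x: "x (Suc l) = closest_point {z. (z - xb l) \<bullet> E (xb l) \<le> 0} (x l)"
      using run by (auto simp: psa_run_def)
    have "ps l \<bullet> E (xb l) \<le> - descent_tol P * \<mu> l * (norm (ps l))\<^sup>2"
      using step(4)[of l] by (simp add: accepted_def xb)
    from halfspace_projection_step_length[OF lip xb this step(1-3) par(1) less_imp_le[OF par(2)]
        psa_run_direction(2,3)[OF run P]]
    show ?thesis by (simp add: x k_def)
  qed
  show ?thesis
  proof
    show "0 < (1 + L) / k" using \<open>0 < k\<close> lipschitz_on_nonneg[OF lip] by simp
    show "norm (E (x l)) \<le> (1 + L) / k * norm (x l - x (Suc l))" for l
      using bound[of l] \<open>0 < k\<close> by (simp add: field_simps)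
  qed
qed

theorem theorem1:
  fixes E :: "real ^ 'n \<Rightarrow> real ^ 'n"
    and x :: "nat \<Rightarrow> real ^ 'n"
    and L :: real
    and P :: psa_params
    and S :: step_rule
    and D :: direction_rule
  assumes "monotone_operator E"
    and "L > 0"
    and "L-lipschitz_on UNIV E"
    and "{z. E z = 0} \<noteq> {}"
    and "valid_params P"
    and "valid_step_rule P L S"
    and "valid_direction_rule D"
    and "psa_generates P S D E x"
  shows "liminf (\<lambda>l. ereal (norm (E (x l)))) = 0
       \<and> (\<exists>xstar \<in> {z. E z = 0}. x \<longlonglongrightarrow> xstar)"
proof -
  obtain xb \<mu> p ps where run: "psa_run P S D E x xb \<mu> p ps"
    using assms(8) by (auto simp: psa_generates_def)
  obtain c where c: "\<And>l. norm (E (x l)) \<le> c * norm (x l - x (Suc l))"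
    using psa_run_step_length[OF run assms(3,5,6)] by metis
  note decrease = psa_run_square_decrease[OF run assms(1)]
  obtain z0 where "E z0 = 0" using assms(4) by blast
  then have "(\<lambda>l. norm (x l - x (Suc l))) \<longlonglongrightarrow> 0"
    using steps_tendsto_zero_of_square_decrease[of x z0] decrease by blast
  then have "(\<lambda>l. c * norm (x l - x (Suc l))) \<longlonglongrightarrow> 0"
    by (rule tendsto_mult_right_zero)
  then have norm0: "(\<lambda>l. norm (E (x l))) \<longlonglongrightarrow> 0"
    by (rule Lim_null_comparison[rotated]) (use c in auto)
  then have E0: "(\<lambda>l. E (x l)) \<longlonglongrightarrow> 0" by (rule tendsto_norm_zero_cancel)
  have cont: "isCont E z" for z
    using lipschitz_on_continuous_on[OF assms(3)] by (simp add: continuous_on_eq_continuous_at)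
  have "\<exists>z\<in>{z. E z = 0}. x \<longlonglongrightarrow> z"
  proof (rule fejer_monotone_convergence[OF _ assms(4)])
    fix z n assume "z \<in> {z. E z = 0}"
    then have "E z = 0" by simp
    from decrease[OF this, of n] have "(norm (x (Suc n) - z))\<^sup>2 \<le> (norm (x n - z))\<^sup>2"
      using zero_le_power2[of "norm (x n - x (Suc n))"] by linarith
    then show "dist (x (Suc n)) z \<le> dist (x n) z"
      unfolding dist_norm by (rule power2_le_imp_le) simp
  next
    fix r z assume r: "strict_mono (r :: nat \<Rightarrow> nat)" "(x \<circ> r) \<longlonglongrightarrow> z"
    have "(\<lambda>k. E ((x \<circ> r) k)) \<longlonglongrightarrow> E z"
      using isCont_tendsto_compose[OF cont r(2)] .
    moreover have "(\<lambda>k. E ((x \<circ> r) k)) \<longlonglongrightarrow> 0"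
      using LIMSEQ_subseq_LIMSEQ[OF E0 r(1)] by (simp add: o_def)
    ultimately show "z \<in> {z. E z = 0}" using LIMSEQ_unique by blast
  qed
  moreover have "(\<lambda>l. ereal (norm (E (x l)))) \<longlonglongrightarrow> ereal 0"
    using norm0 by (simp add: tendsto_ereal)
  then have "liminf (\<lambda>l. ereal (norm (E (x l)))) = 0"
    using lim_imp_Liminf[OF sequentially_bot] by (metis zero_ereal_def)
  ultimately show ?thesis by blast
qed

end
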